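(* Let the canonical Tribonacci representation of $n-1$ be $e_1\cdots e_i$, that of $n-2$ be $f_1\cdots f_j$, and that of $n-4$ be $g_1\cdots g_k$ (each padded with leading zeros if necessary). Then $$N_a(n)=[e_1\cdots e_{i-1}]_T+1\quad(n\ge1),$$ $$N_b(n)=[f_1\cdots f_{j-2}]_T+1\quad(n\ge2),$$ $$N_c(n)=[g_1\cdots g_{k-3}]_T+1\quad(n\ge4).$$
   Context: Tribonacci numbers: $T_{-3}=T_{-2}=0$, $T_{-1}=1$, $T_n=T_{n-1}+T_{n-2}+T_{n-3}$ for $n\ge0$ (so $T_0=1,T_1=2,T_2=4,T_3=7$). For a finite binary string $E=e_1\cdots e_i$, $[E]_T=\sum_{1\le j\le i}e_jT_{i-j}$ (the empty string has value $0$). The canonical Tribonacci representation of an integer $m\ge0$ is the binary string with value $m$ obtained by the greedy algorithm (repeatedly subtracting the largest possible Tribonacci number), least significant digit on the right; up to leading zeros it is the unique binary string $E$ with $[E]_T=m$ containing no three consecutive $1$'s. The Tribonacci word $\mathbf T=t_1t_2t_3\cdots$ is the infinite fixed point, beginning with $a$, of the morphism $\tau: a\to ab,\ b\to ac,\ c\to a$. For $n\ge1$, $N_a(n),N_b(n),N_c(n)$ are the numbers of $a$'s, $b$'s, $c$'s in $t_1\cdots t_n$. *)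

theory Defs
  imports "HOL-Library.Stream"
begin

(* The indices start at -3; all smaller indices are given the junk value 0. *)

function trib :: "int \<Rightarrow> nat" where
  "trib n = (if n < -1 then 0 else if n = -1 then 1
             else trib (n - 1) + trib (n - 2) + trib (n - 3))"
  by auto
termination by (relation "measure (\<lambda>n. nat (n + 3))") auto

declare trib.simps [simp del]

lemma trib_initial: "trib (-3) = 0" "trib (-2) = 0" "trib (-1) = 1"
  by (simp_all add: trib.simps)

lemma trib_rec: "n \<ge> 0 \<Longrightarrow> trib n = trib (n - 1) + trib (n - 2) + trib (n - 3)"
  by (subst trib.simps) simp

lemma trib_values: "trib 0 = 1" "trib 1 = 2" "trib 2 = 4" "trib 3 = 7"
  by (simp_all add: trib_rec trib_initial)

lemma trib_pos: "trib (int k) > 0"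
proof (induction k)
  case 0
  show ?case by (simp add: trib_values)
next
  case (Suc k)
  then show ?case using trib_rec[of "int (Suc k)"] by simp
qed

lemma trib_gt: "k < trib (int k)"
proof (induction k rule: less_induct)
  case (less k)
  show ?case
  proof (cases "k < 2")
    case True
    then have "k = 0 \<or> k = 1" by auto
    then show ?thesis by (auto simp: trib_values)
  next
    case False
    then have "k - 1 < trib (int k - 1)" "0 < trib (int k - 2)"
      using less.IH[of "k - 1"] trib_pos[of "k - 2"] by (auto simp: of_nat_diff)
    then show ?thesis using trib_rec[of "int k"] by simp
  qed
qed

(* [E]_T for E = e_1 ... e_i, where e_j is E ! (j - 1). *)

definition trib_value :: "nat list \<Rightarrow> nat" where
  "trib_value E = (\<Sum>j = 1..length E. E ! (j - 1) * trib (int (length E) - int j))"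

definition largest_trib :: "nat \<Rightarrow> nat" where
  "largest_trib m = (GREATEST k. trib (int k) \<le> m)"

lemma largest_trib_le:
  assumes "m > 0"
  shows "trib (int (largest_trib m)) \<le> m"
proof -
  have "trib (int 0) \<le> m" using assms by (simp add: trib_values)
  moreover have "k \<le> m" if "trib (int k) \<le> m" for k
    using that trib_gt[of k] by simp
  ultimately show ?thesis
    unfolding largest_trib_def by (rule GreatestI_nat[where P = "\<lambda>k. trib (int k) \<le> m"])
qed

(* The indices of the Tribonacci numbers that the greedy algorithm subtracts.  Only indices
   k >= 0 are used, since a digit string has no position for T_{-1}. *)

function greedy :: "nat \<Rightarrow> nat list" where
  "greedy m = (if m = 0 then []
               else largest_trib m # greedy (m - trib (int (largest_trib m))))"
  by auto
termination
proof (relation "measure id")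
  fix m :: nat
  assume "m \<noteq> 0"
  then show "(m - trib (int (largest_trib m)), m) \<in> measure id"
    using trib_pos[of "largest_trib m"] by simp
qed simp

declare greedy.simps [simp del]

(* E is the canonical representation of m, possibly padded with leading zeros; the digit e_j,
   which has weight T_{i-j}, is 1 exactly if T_{i-j} is subtracted. *)

definition canonical_rep :: "nat \<Rightarrow> nat list \<Rightarrow> bool" where
  "canonical_rep m E \<longleftrightarrow>
     (\<forall>k \<in> set (greedy m). k < length E) \<and>
     (\<forall>j \<in> {1..length E}. E ! (j - 1) = of_bool (length E - j \<in> set (greedy m)))"

datatype letter = La | Lb | Lc

fun tau :: "letter \<Rightarrow> letter list" where
  "tau La = [La, Lb]"
| "tau Lb = [La, Lc]"
| "tau Lc = [La]"

definition tau_list :: "letter list \<Rightarrow> letter list" where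
  "tau_list u = concat (map tau u)"

definition tau_stream :: "letter stream \<Rightarrow> letter stream" where
  "tau_stream s = flat (smap tau s)"

(* The letter t_j is tribonacci_word !! (j - 1).  Existence and uniqueness of the fixed point
   are tribonacci_word_ex1 below. *)

definition tribonacci_word :: "letter stream" where
  "tribonacci_word = (THE s. tau_stream s = s \<and> shd s = La)"

definition letter_count :: "letter \<Rightarrow> nat \<Rightarrow> nat" where
  "letter_count x n = count_list (stake n tribonacci_word) x"

lemma tau_nonempty: "tau x \<noteq> []"
  by (cases x) auto

lemma tau_stream_shift: "tau_stream (u @- s) = tau_list u @- tau_stream s"
  by (induction u) (auto simp: tau_stream_def tau_list_def tau_nonempty)

abbreviation tau_pow :: "nat \<Rightarrow> letter list" where
  "tau_pow n \<equiv> (tau_list ^^ n) [La]"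

lemma tau_list_append: "tau_list (u @ v) = tau_list u @ tau_list v"
  by (simp add: tau_list_def)

lemma tau_list_nonempty: "u \<noteq> [] \<Longrightarrow> tau_list u \<noteq> []"
  by (cases u) (auto simp: tau_list_def tau_nonempty)

lemma tau_pow_Suc: "\<exists>v. v \<noteq> [] \<and> tau_pow (Suc n) = tau_pow n @ v"
proof (induction n)
  case 0
  show ?case by (simp add: tau_list_def)
next
  case (Suc n)
  then obtain v where v: "v \<noteq> []" "tau_pow (Suc n) = tau_pow n @ v" by blast
  then have "tau_pow (Suc (Suc n)) = tau_list (tau_pow n @ v)" by simp
  also have "\<dots> = tau_pow (Suc n) @ tau_list v" by (simp add: tau_list_append)
  finally show ?case using tau_list_nonempty[OF v(1)] by blast
qed

lemma tau_pow_length: "n < length (tau_pow n)"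
proof (induction n)
  case (Suc n)
  obtain v where v: "v \<noteq> []" "tau_pow (Suc n) = tau_pow n @ v" using tau_pow_Suc by blast
  have "length (tau_pow (Suc n)) = length (tau_pow n) + length v" unfolding v(2) by simp
  moreover have "length v > 0" using v(1) by simp
  ultimately show ?case using Suc by linarith
qed simp

lemma tau_pow_prefix: "m \<le> n \<Longrightarrow> \<exists>v. tau_pow n = tau_pow m @ v"
proof (induction n rule: dec_induct)
  case (step n)
  then show ?case using tau_pow_Suc[of n] by (metis append.assoc)
qed simp

lemma tau_pow_nth:
  assumes "i < length (tau_pow m)" "i < length (tau_pow n)"
  shows "tau_pow m ! i = tau_pow n ! i"
proof (cases "m \<le> n")
  case True
  then show ?thesis using tau_pow_prefix[OF True] assms by (auto simp: nth_append)
next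
  case False
  then have "n \<le> m" by simp
  then show ?thesis using tau_pow_prefix[of n m] assms by (auto simp: nth_append)
qed

lemma fixed_point_prefix:
  assumes "tau_stream s = s" "shd s = La"
  shows "\<exists>s'. s = tau_pow n @- s'"
proof (induction n)
  case 0
  show ?case using assms(2) by (intro exI[of _ "stl s"]) (metis eq_id_iff funpow_0
    shift.simps stream.collapse)
next
  case (Suc n)
  then obtain s' where "s = tau_pow n @- s'" by blast
  then have "s = tau_list (tau_pow n) @- tau_stream s'"
    using assms(1) tau_stream_shift by metis
  then show ?case by auto
qed

lemma fixed_point_nth:
  assumes "\<exists>s'. s = tau_pow (Suc n) @- s'"
  shows "s !! n = tau_pow (Suc n) ! n"
  using assms tau_pow_length[of "Suc n"] by auto

lemma snth_eqI: "(\<And>n. s !! n = t !! n) \<Longrightarrow> s = t"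
  using smap_alt[of id s t] by (simp add: stream.map_id)

lemma tribonacci_word_ex1: "\<exists>!s. tau_stream s = s \<and> shd s = La"
proof (rule ex_ex1I)
  define w where "w = smap (\<lambda>i. tau_pow (Suc i) ! i) nats"
  have w_nth: "w !! i = tau_pow n ! i" if "i < length (tau_pow n)" for i n
    unfolding w_def using that tau_pow_length[of "Suc i"] tau_pow_nth[of i "Suc i" n]
    by (simp del: funpow.simps)
  have prefix: "w = tau_pow n @- sdrop (length (tau_pow n)) w" for n
  proof -
    have "stake (length (tau_pow n)) w = tau_pow n"
      by (rule nth_equalityI) (simp_all add: w_nth)
    then show ?thesis by (metis stake_sdrop)
  qed
  have "tau_stream w !! i = w !! i" for i
  proof -
    have "tau_stream w = tau_pow (Suc i) @- tau_stream (sdrop (length (tau_pow i)) w)"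
      using tau_stream_shift prefix[of i] by (metis comp_apply funpow.simps(2))
    then show ?thesis
      using fixed_point_nth w_nth[of i "Suc i"] tau_pow_length[of "Suc i"]
      by (metis Suc_lessD)
  qed
  then have "tau_stream w = w" by (intro snth_eqI)
  moreover have "shd w = La" using w_nth[of 0 0] by simp
  ultimately show "\<exists>s. tau_stream s = s \<and> shd s = La" by blast
next
  fix s t
  assume "tau_stream s = s \<and> shd s = La" "tau_stream t = t \<and> shd t = La"
  then have "s !! n = t !! n" for n
    using fixed_point_prefix fixed_point_nth by metis
  then show "s = t" by (intro snth_eqI)
qed

lemma tribonacci_word_fixed: "tau_stream tribonacci_word = tribonacci_word"
  and tribonacci_word_shd: "shd tribonacci_word = La"
  using theI'[OF tribonacci_word_ex1] by (simp_all add: tribonacci_word_def)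

end

theory Submission
  imports Defs
begin

text \<open>
  The argument compares two decompositions of the prefixes of the Tribonacci word \<open>t\<close>.

  The first one is by digits.  Say that a binary string is admissible if it has no factor \<open>111\<close>;
  canonical representations are admissible, because the greedy algorithm leaves a remainder less
  than \<open>T\<^bsub>k+1\<^esub> - T\<^sub>k = T\<^bsub>k-1\<^esub> + T\<^bsub>k-2\<^esub>\<close> when it subtracts \<open>T\<^sub>k\<close>.  An admissible string \<open>E\<close> describes the
  prefix \<open>u\<close> of \<open>t\<close> of length \<open>[E]\<close>: appending a digit \<open>d\<close> to \<open>E\<close> replaces \<open>u\<close> by \<open>\<tau>(u)\<close>,
  followed by a letter \<open>a\<close> if \<open>d = 1\<close>.  The letter of \<open>t\<close> after \<open>u\<close> is \<open>a\<close>, \<open>b\<close> or \<open>c\<close> according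
  to whether \<open>E\<close> ends in no \<open>1\<close>, in one \<open>1\<close> or in two \<open>1\<close>s.  Since each letter has exactly one
  \<open>a\<close> in its image under \<open>\<tau>\<close>, the prefix that belongs to \<open>Ed\<close> has \<open>[E] + d\<close> letters \<open>a\<close>, and the
  next letter is \<open>a\<close> exactly if \<open>d = 0\<close>.  Hence \<open>N\<^sub>a([Ed] + 1) = [E] + 1\<close> (lemma
  \<open>letter_count_La_trib_value\<close>), which is the first formula.

  The second one is by blocks \<open>\<tau>(t\<^sub>1), \<tau>(t\<^sub>2), \<dots>\<close>.  Among the first \<open>n\<close> letters, \<open>N\<^sub>a(n)\<close> blocks
  have begun.  A letter \<open>b\<close> or \<open>c\<close> comes immediately after the first letter of its block, which is
  the image of an \<open>a\<close> or of a \<open>b\<close>, respectively.  Hence \<open>N\<^sub>b(n+1) = N\<^sub>a(N\<^sub>a(n))\<close> and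
  \<open>N\<^sub>c(n+1) = N\<^sub>b(N\<^sub>a(n))\<close>.  Applying the first formula twice gives the second one.  For the third,
  \<open>N\<^sub>c(k+3) = N\<^sub>b(N\<^sub>a(k+2)) = N\<^sub>b(N\<^sub>a(k)+1) = N\<^sub>a(N\<^sub>a(N\<^sub>a(k)))\<close> for \<open>k \<ge> 1\<close>; the step in the middle
  is lemma \<open>letter_count_Lb_step\<close>.
\<close>

section \<open>Prefixes of the Tribonacci word and the morphism\<close>

text \<open>\<open>trib_prefix u\<close>: the finite word \<open>u\<close> is a prefix of the Tribonacci word.\<close>

definition trib_prefix :: "letter list \<Rightarrow> bool" where
  "trib_prefix u \<longleftrightarrow> (\<exists>s. tribonacci_word = u @- s)"

lemma trib_prefix_append: "trib_prefix (u @ v) \<Longrightarrow> trib_prefix u"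
  by (auto simp: trib_prefix_def)

lemma trib_prefix_stake: "trib_prefix (stake n tribonacci_word)"
  unfolding trib_prefix_def by (metis stake_sdrop)

lemma letter_count_prefix:
  assumes "trib_prefix u" "n = length u"
  shows "letter_count x n = count_list u x"
proof -
  obtain s where s: "tribonacci_word = u @- s" using assms(1) by (auto simp: trib_prefix_def)
  have "stake n tribonacci_word = u" unfolding s using assms(2) by (simp add: stake_shift)
  then show ?thesis by (simp add: letter_count_def)
qed

lemma shd_tau_stream: "shd (tau_stream s) = La"
  by (cases "shd s") (auto simp: tau_stream_def)

text \<open>The image of a prefix is followed by the beginning of another block, which is an \<open>a\<close>.\<close>

lemma trib_prefix_tau:
  assumes "trib_prefix u"
  shows "trib_prefix (tau_list u @ [La])"
proof -
  obtain s where "tribonacci_word = u @- s" using assms by (auto simp: trib_prefix_def)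
  then have "tribonacci_word = tau_list u @- tau_stream s"
    by (metis tribonacci_word_fixed tau_stream_shift)
  also have "\<dots> = (tau_list u @ [La]) @- stl (tau_stream s)"
    using shd_tau_stream[of s] stream.collapse[of "tau_stream s"] by simp
  finally show ?thesis by (auto simp: trib_prefix_def)
qed

lemma count_tau_list:
  "count_list (tau_list u) La = length u"
  "count_list (tau_list u) Lb = count_list u La"
  "count_list (tau_list u) Lc = count_list u Lb"
proof -
  have "count_list (tau_list u) La = length u \<and> count_list (tau_list u) Lb = count_list u La
    \<and> count_list (tau_list u) Lc = count_list u Lb"
  proof (induction u)
    case (Cons x u)
    then show ?case by (cases x) (auto simp: tau_list_def)
  qed (simp add: tau_list_def)
  then show "count_list (tau_list u) La = length u"
    "count_list (tau_list u) Lb = count_list u La"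
    "count_list (tau_list u) Lc = count_list u Lb" by auto
qed

lemma length_eq_count_letters:
  "length u = count_list u La + count_list u Lb + count_list u Lc"
proof (induction u)
  case (Cons x u)
  then show ?case by (cases x) auto
qed simp

section \<open>Counting letters through blocks\<close>

text \<open>Length of the first \<open>q\<close> blocks.\<close>

definition block_end :: "nat \<Rightarrow> nat" where
  "block_end q = length (tau_list (stake q tribonacci_word))"

lemma block_end_Suc:
  "block_end (Suc q) = block_end q + length (tau (tribonacci_word !! q))"
  by (simp add: block_end_def stake_Suc tau_list_def del: stake.simps(2))

lemma letter_count_Suc:
  "letter_count x (Suc q) = letter_count x q + of_bool (tribonacci_word !! q = x)"
  by (simp add: letter_count_def stake_Suc del: stake.simps(2))

text \<open>The number of letters \<open>x\<close> in the image of a prefix of length \<open>q\<close>.\<close>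

fun block_count :: "letter \<Rightarrow> nat \<Rightarrow> nat" where
  "block_count La q = q"
| "block_count Lb q = letter_count La q"
| "block_count Lc q = letter_count Lb q"

lemma count_tau_list_stake:
  "count_list (tau_list (stake q tribonacci_word)) x = block_count x q"
  by (cases x) (simp_all add: count_tau_list letter_count_def)

lemma letter_count_block_end_Suc:
  "letter_count x (block_end q + 1) = block_count x q + of_bool (x = La)"
  by (subst letter_count_prefix[OF trib_prefix_tau[OF trib_prefix_stake[of q]]])
    (auto simp: block_end_def count_tau_list_stake)

lemma letter_count_block_end_Suc_Suc:
  assumes "tribonacci_word !! q \<noteq> Lc"
  shows "letter_count x (block_end q + 2) = block_count x (Suc q)"
proof -
  have "block_end (Suc q) = block_end q + 2"
    using assms by (cases "tribonacci_word !! q") (auto simp: block_end_Suc)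
  then show ?thesis
    using letter_count_prefix
      [OF trib_prefix_append[OF trib_prefix_tau[OF trib_prefix_stake[of "Suc q"]]], of _ x]
    by (auto simp: block_end_def count_tau_list_stake simp del: stake.simps(2))
qed

lemma block_end_Lc: "tribonacci_word !! q = Lc \<Longrightarrow> block_end (Suc q) = block_end q + 1"
  by (simp add: block_end_Suc)

lemma block_end_not_Lc: "tribonacci_word !! q \<noteq> Lc \<Longrightarrow> block_end (Suc q) = block_end q + 2"
  by (cases "tribonacci_word !! q") (simp_all add: block_end_Suc)

text \<open>The \<open>n\<close>-th letter is the first or the second letter of the block \<open>\<tau>(t\<^bsub>q+1\<^esub>)\<close> for some
  \<open>q\<close>.  Streams are indexed from \<open>0\<close>, so \<open>t\<^bsub>q+1\<^esub>\<close> is \<open>tribonacci_word !! q\<close>.\<close>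

lemma block_cases:
  assumes "n \<ge> 1"
  obtains (first) q where "n = block_end q + 1"
  | (second) q where "n = block_end q + 2" "tribonacci_word !! q \<noteq> Lc"
proof -
  have "\<exists>q. n = block_end q + 1 \<or> n = block_end q + 2 \<and> tribonacci_word !! q \<noteq> Lc"
    using assms
  proof (induction n rule: dec_induct)
    case base
    show ?case by (rule exI[of _ 0]) (simp add: block_end_def tau_list_def)
  next
    case (step n)
    then obtain q where
      q: "n = block_end q + 1 \<or> n = block_end q + 2 \<and> tribonacci_word !! q \<noteq> Lc" by blast
    show ?case
    proof (cases "n = block_end q + 1 \<and> tribonacci_word !! q \<noteq> Lc")
      case True
      then show ?thesis by auto
    next
      case False
      then have "Suc n = block_end (Suc q) + 1"
        using q block_end_Lc[of q] block_end_not_Lc[of q] by auto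
      then show ?thesis by blast
    qed
  qed
  then show ?thesis using that by blast
qed

lemma letter_count_La_first: "letter_count La (block_end q + 1) = Suc q"
  by (simp add: letter_count_block_end_Suc del: One_nat_def)

lemma letter_count_La_second:
  "tribonacci_word !! q \<noteq> Lc \<Longrightarrow> letter_count La (block_end q + 2) = Suc q"
  by (simp add: letter_count_block_end_Suc_Suc del: add_2_eq_Suc')

text \<open>A letter \<open>b\<close> or \<open>c\<close> occurs among the first \<open>n + 1\<close> letters exactly if its block has begun
  among the first \<open>n\<close>; \<open>block_count\<close> counts these letters in the blocks that have begun.\<close>

lemma letter_count_Suc_block:
  assumes "n \<ge> 1" "x \<noteq> La"
  shows "letter_count x (Suc n) = block_count x (letter_count La n)"
  using assms(1)
proof (cases rule: block_cases)
  case (first q)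
  show ?thesis
  proof (cases "tribonacci_word !! q = Lc")
    case True
    \<comment> \<open>The block of letter \<open>n\<close> is the single letter \<open>a\<close>, and letter \<open>n + 1\<close> begins the next block.\<close>
    then have "Suc n = block_end (Suc q) + 1" using first block_end_Lc[of q] by simp
    then have "letter_count x (Suc n) = block_count x (Suc q)"
      using letter_count_block_end_Suc[of x "Suc q"] assms(2) by simp
    then show ?thesis using letter_count_La_first[of q] first by simp
  next
    case False
    then show ?thesis
      using letter_count_block_end_Suc_Suc[OF False, of x] letter_count_La_first[of q] first
      by simp
  qed
next
  case (second q)
  then have "Suc n = block_end (Suc q) + 1" using block_end_not_Lc[of q] by simp
  then have "letter_count x (Suc n) = block_count x (Suc q)"
    using letter_count_block_end_Suc[of x "Suc q"] assms(2) by simp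
  then show ?thesis using letter_count_La_second[of q] second by simp
qed

lemma letter_count_Lb_Suc:
  "n \<ge> 1 \<Longrightarrow> letter_count Lb (Suc n) = letter_count La (letter_count La n)"
  by (simp add: letter_count_Suc_block)

lemma letter_count_Lc_Suc:
  "n \<ge> 1 \<Longrightarrow> letter_count Lc (Suc n) = letter_count Lb (letter_count La n)"
  by (simp add: letter_count_Suc_block)

lemma letter_count_La_block_end: "letter_count La (block_end q) = q"
proof -
  have "letter_count La (block_end q) = count_list (tau_list (stake q tribonacci_word)) La"
    by (rule letter_count_prefix
        [OF trib_prefix_append[OF trib_prefix_tau[OF trib_prefix_stake[of q]]]])
      (simp add: block_end_def)
  then show ?thesis by (simp add: count_tau_list_stake)
qed

text \<open>Usually exactly one block begins at the positions \<open>k + 1\<close> and \<open>k + 2\<close>.  If two do, then the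
  first of them is the image of a letter \<open>c\<close>; since \<open>N\<^sub>b(n+1)\<close> depends only on \<open>N\<^sub>a(n)\<close>, and \<open>c\<close> does
  not contribute to \<open>N\<^sub>a\<close>, the extra block does not change the count.\<close>

lemma letter_count_Lb_step:
  assumes "k \<ge> 1"
  shows "letter_count Lb (letter_count La (k + 2)) = letter_count Lb (letter_count La k + 1)"
proof -
  have "k + 1 \<ge> 1" by simp
  then show ?thesis
  proof (cases rule: block_cases)
    case (first r)
    then have k: "k = block_end r" by simp
    then have Nk: "letter_count La k = r" by (simp add: letter_count_La_block_end)
    show ?thesis
    proof (cases "tribonacci_word !! r = Lc")
      case True
      have "r \<ge> 1" using assms k by (cases r) (auto simp: block_end_def tau_list_def)
      have "k + 2 = block_end (Suc r) + 1" using k block_end_Lc[OF True] by simp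
      then have "letter_count La (k + 2) = Suc (Suc r)" by (metis letter_count_La_first)
      moreover have "letter_count La (Suc r) = letter_count La r"
        using True by (simp add: letter_count_Suc)
      ultimately show ?thesis
        using Nk \<open>r \<ge> 1\<close> letter_count_Lb_Suc[of r] letter_count_Lb_Suc[of "Suc r"] by simp
    next
      case False
      then show ?thesis using Nk k letter_count_La_second[OF False] by simp
    qed
  next
    case (second r)
    then have "k = block_end r + 1" "k + 2 = block_end (Suc r) + 1"
      using block_end_not_Lc[of r] by simp_all
    then have "letter_count La k = Suc r" "letter_count La (k + 2) = Suc (Suc r)"
      by (metis letter_count_La_first)+
    then show ?thesis by simp
  qed
qed

section \<open>Admissible digit strings\<close>

text \<open>Binary strings without three consecutive \<open>1\<close>s.  As in \<open>trib_value\<close>, the least significant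
  digit is the last one.\<close>

definition admissible :: "nat list \<Rightarrow> bool" where
  "admissible E \<longleftrightarrow> set E \<subseteq> {0, 1} \<and> (\<nexists>u v. E = u @ [1, 1, 1] @ v)"

lemma admissible_append: "admissible (E @ F) \<Longrightarrow> admissible E"
  unfolding admissible_def by (metis append.assoc le_sup_iff set_append)

text \<open>The value of \<open>E\<close> with every weight \<open>T\<^sub>i\<close> replaced by \<open>T\<^bsub>i-r\<^esub>\<close>.\<close>

definition shifted_value :: "nat \<Rightarrow> nat list \<Rightarrow> nat" where
  "shifted_value r E = (\<Sum>i<length E. rev E ! i * trib (int i - int r))"

lemma trib_value_conv_shifted: "trib_value E = shifted_value 0 E"
  unfolding trib_value_def shifted_value_def
  by (rule sum.reindex_bij_witness[where i = "\<lambda>i. length E - i" and j = "\<lambda>j. length E - j"])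
    (auto simp: rev_nth of_nat_diff)

lemma shifted_value_Nil [simp]: "shifted_value r [] = 0"
  by (simp add: shifted_value_def)

lemma shifted_value_snoc:
  "shifted_value (Suc r) (E @ [d]) = shifted_value r E + d * trib (- int (Suc r))"
  by (simp add: shifted_value_def sum.lessThan_Suc_shift del: sum.lessThan_Suc)

lemma shifted_value_rec:
  "shifted_value 0 E = shifted_value 1 E + shifted_value 2 E + shifted_value 3 E"
  by (simp add: shifted_value_def trib_rec distrib_left flip: sum.distrib)

text \<open>The prefix \<open>u\<close> described by \<open>E\<close>, and the letter \<open>x\<close> that follows it.  A digit \<open>1\<close> of weight
  \<open>T\<^sub>i\<close> stands for a factor \<open>\<tau>\<^sup>i(a)\<close> of \<open>u\<close>, which has \<open>T\<^bsub>i-1\<^esub>\<close> letters \<open>a\<close>, \<open>T\<^bsub>i-2\<^esub>\<close> letters \<open>b\<close> and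
  \<open>T\<^bsub>i-3\<^esub>\<close> letters \<open>c\<close>; in total, \<open>u\<close> has length \<open>[E]\<close>.\<close>

lemma admissible_prefix:
  assumes "admissible E"
  shows "\<exists>u x. trib_prefix (u @ [x]) \<and>
    count_list u La = shifted_value 1 E \<and> count_list u Lb = shifted_value 2 E \<and>
    count_list u Lc = shifted_value 3 E \<and>
    (x = La \<longleftrightarrow> \<not> (\<exists>F. E = F @ [1])) \<and> (x = Lc \<longrightarrow> (\<exists>F. E = F @ [1, 1]))"
  using assms
proof (induction E rule: rev_induct)
  case Nil
  have "trib_prefix ([] @ [La])"
    using trib_prefix_tau[OF trib_prefix_stake[of 0]] by (simp add: tau_list_def)
  then show ?case by (intro exI[of _ "[]"] exI[of _ La]) simp
next
  case (snoc d E)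
  then obtain u x where ux: "trib_prefix (u @ [x])"
      "count_list u La = shifted_value 1 E" "count_list u Lb = shifted_value 2 E"
      "count_list u Lc = shifted_value 3 E"
      "x = La \<longleftrightarrow> \<not> (\<exists>F. E = F @ [1])" "x = Lc \<longrightarrow> (\<exists>F. E = F @ [1, 1])"
    using admissible_append by blast
  have len: "length u = shifted_value 0 E"
    using length_eq_count_letters[of u] shifted_value_rec[of E] ux by simp
  have weights: "shifted_value 1 (E @ [d]) = shifted_value 0 E + d"
      "shifted_value 2 (E @ [d]) = shifted_value 1 E"
      "shifted_value 3 (E @ [d]) = shifted_value 2 E"
    using shifted_value_snoc[of 0 E d] shifted_value_snoc[of 1 E d] shifted_value_snoc[of 2 E d]
    by (simp_all add: trib_initial numeral_2_eq_2 numeral_3_eq_3)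
  have image: "trib_prefix (tau_list u @ tau x @ [La])"
    using trib_prefix_tau[OF ux(1)] by (simp add: tau_list_append) (simp add: tau_list_def)
  have "d = 0 \<or> d = 1" using snoc.prems by (auto simp: admissible_def)
  then show ?case
  proof
    assume "d = 0"
    have "trib_prefix (tau_list u @ [La])"
      using trib_prefix_tau[OF trib_prefix_append[OF ux(1)]] .
    then show ?thesis using \<open>d = 0\<close> ux len weights
      by (intro exI[of _ "tau_list u"] exI[of _ La]) (simp add: count_tau_list)
  next
    assume "d = 1"
    have "x \<noteq> Lc"
    proof
      assume "x = Lc"
      then obtain F where "E @ [d] = F @ [1, 1, 1] @ []" using ux(6) \<open>d = 1\<close> by auto
      then show False using snoc.prems unfolding admissible_def by blast
    qed
    define y where "y = (if x = La then Lb else Lc)"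
    have "tau x @ [La] = [La, y] @ [La]" using \<open>x \<noteq> Lc\<close> by (cases x) (simp_all add: y_def)
    then have "trib_prefix (((tau_list u @ [La]) @ [y]) @ [La])" using image by simp
    then have "trib_prefix ((tau_list u @ [La]) @ [y])" by (rule trib_prefix_append)
    moreover have "y = Lc \<longrightarrow> (\<exists>F. E @ [d] = F @ [1, 1])"
      using ux(5) \<open>d = 1\<close> by (auto simp: y_def)
    ultimately show ?thesis using \<open>d = 1\<close> ux(2,3) len weights
      by (intro exI[of _ "tau_list u @ [La]"] exI[of _ y]) (simp add: count_tau_list y_def)
  qed
qed

text \<open>Deleting the last digit of \<open>n\<close> gives \<open>N\<^sub>a(n+1) - 1\<close>.\<close>

lemma letter_count_La_trib_value:
  assumes "admissible E" "E \<noteq> []"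
  shows "letter_count La (trib_value E + 1) = trib_value (butlast E) + 1"
proof -
  obtain u x where ux: "trib_prefix (u @ [x])"
      "count_list u La = shifted_value 1 E" "count_list u Lb = shifted_value 2 E"
      "count_list u Lc = shifted_value 3 E" "x = La \<longleftrightarrow> \<not> (\<exists>F. E = F @ [1])"
    using admissible_prefix[OF assms(1)] by blast
  obtain F d where E: "E = F @ [d]" using assms(2) by (metis rev_exhaust)
  have d: "d = 0 \<or> d = 1" using assms(1) by (auto simp: admissible_def E)
  have "length u = trib_value E"
    using length_eq_count_letters[of u] shifted_value_rec[of E] ux
    by (simp add: trib_value_conv_shifted)
  then have "letter_count La (trib_value E + 1) = count_list (u @ [x]) La"
    by (intro letter_count_prefix[OF ux(1)]) simp
  also have "\<dots> = shifted_value 0 F + 1"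
    \<comment> \<open>The summand \<open>1\<close> is the last digit \<open>d\<close> if \<open>d = 1\<close>, and the next letter \<open>x = a\<close> if \<open>d = 0\<close>.\<close>
    using d ux(2,5) shifted_value_snoc[of 0 F d] by (auto simp: E trib_initial)
  finally show ?thesis by (simp add: E trib_value_conv_shifted)
qed

section \<open>The greedy algorithm\<close>

lemma largest_trib_less: "m < trib (int (largest_trib m) + 1)"
proof (rule ccontr)
  assume "\<not> ?thesis"
  then have "trib (int (Suc (largest_trib m))) \<le> m" by (simp add: add.commute)
  moreover have "k \<le> m" if "trib (int k) \<le> m" for k
    using that trib_gt[of k] by simp
  ultimately have "Suc (largest_trib m) \<le> largest_trib m"
    unfolding largest_trib_def by (rule Greatest_le_nat[where P = "\<lambda>k. trib (int k) \<le> m"])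
  then show False by simp
qed

text \<open>\<open>T\<^bsub>k+1\<^esub> \<le> 2T\<^sub>k\<close>, so the greedy algorithm subtracts no Tribonacci number twice.\<close>

lemma trib_two_pred_le: "trib (int k - 1) + trib (int k - 2) \<le> trib (int k)"
  by (simp add: trib_rec)

lemma trib_Suc: "trib (int k + 1) = trib (int k) + trib (int k - 1) + trib (int k - 2)"
  by (simp add: trib_rec)

lemma trib_mono: "j \<le> k \<Longrightarrow> trib (int j) \<le> trib (int k)"
proof (induction k rule: dec_induct)
  case (step k)
  then show ?case using trib_Suc[of k] by (simp add: add.commute)
qed simp

lemma greedy_step:
  assumes "m > 0"
  defines "h \<equiv> largest_trib m"
  shows "greedy m = h # greedy (m - trib (int h))"
    and "trib (int h) \<le> m"
    and "m - trib (int h) < trib (int h - 1) + trib (int h - 2)"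
  using assms greedy.simps[of m] largest_trib_le[of m] largest_trib_less[of m] trib_Suc[of h]
  by auto

lemma sum_list_greedy: "sum_list (map (\<lambda>k. trib (int k)) (greedy m)) = m"
proof (induction m rule: less_induct)
  case (less m)
  show ?case
  proof (cases "m = 0")
    case False
    then show ?thesis
      using greedy_step[of m] less[of "m - trib (int (largest_trib m))"]
        trib_pos[of "largest_trib m"] by simp
  qed (simp add: greedy.simps)
qed

lemma trib_greedy_le: "k \<in> set (greedy m) \<Longrightarrow> trib (int k) \<le> m"
  using member_le_sum_list[of "trib (int k)" "map (\<lambda>k. trib (int k)) (greedy m)"]
  by (auto simp: sum_list_greedy)

lemma greedy_tail_less:
  assumes "m > 0" "k \<in> set (greedy (m - trib (int (largest_trib m))))"
  shows "k < largest_trib m"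
proof (rule ccontr)
  assume "\<not> ?thesis"
  then have "trib (int (largest_trib m)) \<le> trib (int k)" by (intro trib_mono) simp
  also have "\<dots> \<le> m - trib (int (largest_trib m))" using trib_greedy_le[OF assms(2)] .
  also have "\<dots> < trib (int (largest_trib m))"
    using greedy_step(3)[OF assms(1)] trib_two_pred_le[of "largest_trib m"] by simp
  finally show False by simp
qed

lemma distinct_greedy: "distinct (greedy m)"
proof (induction m rule: less_induct)
  case (less m)
  show ?case
  proof (cases "m = 0")
    case False
    then show ?thesis
      using greedy_step[of m] less[of "m - trib (int (largest_trib m))"]
        trib_pos[of "largest_trib m"] greedy_tail_less[of m] by auto
  qed (simp add: greedy.simps)
qed

lemma sum_greedy: "(\<Sum>k\<in>set (greedy m). trib (int k)) = m"
  using sum_list_greedy[of m] by (simp add: sum_list_distinct_conv_sum_set distinct_greedy)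

lemma greedy_no_three_consecutive:
  "\<not> (k \<in> set (greedy m) \<and> Suc k \<in> set (greedy m) \<and> Suc (Suc k) \<in> set (greedy m))"
proof (induction m rule: less_induct)
  case (less m)
  show ?case
  proof (cases "m = 0")
    case True
    then show ?thesis by (simp add: greedy.simps)
  next
    case False
    define h r where "h = largest_trib m" and "r = m - trib (int h)"
    have greedy_m: "greedy m = h # greedy r" and "r < m"
      and r: "r < trib (int h - 1) + trib (int h - 2)"
      and below: "\<And>j. j \<in> set (greedy r) \<Longrightarrow> j < h"
      using False greedy_step[of m] trib_pos[of h] greedy_tail_less[of m]
      by (auto simp: h_def r_def)
    show ?thesis
    proof
      assume asm: "k \<in> set (greedy m) \<and> Suc k \<in> set (greedy m) \<and> Suc (Suc k) \<in> set (greedy m)"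
      show False
      proof (cases "h = Suc (Suc k)")
        case True
        \<comment> \<open>The remainder \<open>r\<close> is too small to contain both \<open>T\<^bsub>h-1\<^esub>\<close> and \<open>T\<^bsub>h-2\<^esub>\<close>.\<close>
        then have "{k, Suc k} \<subseteq> set (greedy r)" using asm greedy_m by auto
        then have "(\<Sum>j\<in>{k, Suc k}. trib (int j)) \<le> (\<Sum>j\<in>set (greedy r). trib (int j))"
          by (intro sum_mono2) auto
        then show False using r True by (simp add: sum_greedy add.commute)
      next
        case False
        then have "k \<in> set (greedy r) \<and> Suc k \<in> set (greedy r) \<and> Suc (Suc k) \<in> set (greedy r)"
          using asm greedy_m below by fastforce
        then show False using less[OF \<open>r < m\<close>] by blast
      qed
    qed
  qed
qed

lemma canonical_rep_nth:
  assumes "canonical_rep m E" "i < length E"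
  shows "E ! i = of_bool (length E - Suc i \<in> set (greedy m))"
proof -
  have "Suc i \<in> {1..length E}" using assms(2) by simp
  then have "E ! (Suc i - 1) = of_bool (length E - Suc i \<in> set (greedy m))"
    using assms(1) unfolding canonical_rep_def by blast
  then show ?thesis by simp
qed

lemma canonical_rep_admissible:
  assumes "canonical_rep m E"
  shows "admissible E"
  unfolding admissible_def
proof
  show "set E \<subseteq> {0, 1}"
    using canonical_rep_nth[OF assms] by (auto simp: in_set_conv_nth)
  show "\<nexists>u v. E = u @ [1, 1, 1] @ v"
  proof
    assume "\<exists>u v. E = u @ [1, 1, 1] @ v"
    then obtain u v where E: "E = u @ [1, 1, 1] @ v" by blast
    have "length E - Suc (length u + i) \<in> set (greedy m)" if "i < 3" for i
    proof -
      have "E ! (length u + i) = 1" using that by (auto simp: E nth_append less_Suc_eq numeral_3_eq_3)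
      moreover have "length u + i < length E" using that by (simp add: E)
      ultimately show ?thesis using canonical_rep_nth[OF assms] by (metis of_bool_eq(1) zero_neq_one)
    qed
    from this[of 0] this[of 1] this[of 2]
    have "Suc (Suc (length v)) \<in> set (greedy m)" "Suc (length v) \<in> set (greedy m)"
      "length v \<in> set (greedy m)"
      by (simp_all add: E)
    then show False using greedy_no_three_consecutive by blast
  qed
qed

lemma canonical_rep_value:
  assumes "canonical_rep m E"
  shows "trib_value E = m"
proof -
  have "set (greedy m) \<subseteq> {..<length E}" using assms by (auto simp: canonical_rep_def)
  have "trib_value E = (\<Sum>i<length E. of_bool (i \<in> set (greedy m)) * trib (int i))"
    unfolding trib_value_conv_shifted shifted_value_def
    by (intro sum.cong) (auto simp: rev_nth canonical_rep_nth[OF assms])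
  also have "\<dots> = (\<Sum>i\<in>set (greedy m). trib (int i))"
    using \<open>set (greedy m) \<subseteq> {..<length E}\<close> by (intro sum.mono_neutral_cong_right) auto
  finally show ?thesis by (simp add: sum_greedy)
qed

section \<open>The three formulas\<close>

theorem theorem13:
  fixes n :: nat and e f g :: "nat list"
  shows
    "(n \<ge> 1 \<and> canonical_rep (n - 1) e \<and> length e \<ge> 1 \<longrightarrow>
        letter_count La n = trib_value (take (length e - 1) e) + 1) \<and>
     (n \<ge> 2 \<and> canonical_rep (n - 2) f \<and> length f \<ge> 2 \<longrightarrow>
        letter_count Lb n = trib_value (take (length f - 2) f) + 1) \<and>
     (n \<ge> 4 \<and> canonical_rep (n - 4) g \<and> length g \<ge> 3 \<longrightarrow>
        letter_count Lc n = trib_value (take (length g - 3) g) + 1)"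
proof (intro conjI impI; elim conjE)
  have step: "letter_count La (trib_value (take (length E - i) E) + 1) =
      trib_value (take (length E - Suc i) E) + 1"
    if "admissible E" "i < length E" for E i
  proof -
    have "admissible (take (length E - i) E)"
      using that(1) admissible_append[of "take (length E - i) E" "drop (length E - i) E"] by simp
    moreover have "take (length E - i) E \<noteq> []" using that(2) by auto
    ultimately show ?thesis
      using letter_count_La_trib_value[of "take (length E - i) E"] by (simp add: butlast_take)
  qed
  {
    assume "n \<ge> 1" "canonical_rep (n - 1) e" "length e \<ge> 1"
    then show "letter_count La n = trib_value (take (length e - 1) e) + 1"
      using step[of e 0] canonical_rep_value[of "n - 1" e] canonical_rep_admissible[of "n - 1" e]
      by (auto simp flip: length_greater_0_conv)
  next
    assume f: "n \<ge> 2" "canonical_rep (n - 2) f" "length f \<ge> 2"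
    then have "n = Suc (trib_value f + 1)" using canonical_rep_value[OF f(2)] by simp
    then have "letter_count Lb n = letter_count La (letter_count La (trib_value f + 1))"
      by (simp only: letter_count_Lb_Suc)
    also have "\<dots> = trib_value (take (length f - 2) f) + 1"
      using step[of f 0] step[of f 1] f canonical_rep_admissible[OF f(2)]
      by (auto simp: numeral_2_eq_2 simp flip: length_greater_0_conv)
    finally show "letter_count Lb n = trib_value (take (length f - 2) f) + 1" .
  next
    assume g: "n \<ge> 4" "canonical_rep (n - 4) g" "length g \<ge> 3"
    define k where "k = trib_value g + 1"
    have "n = Suc (k + 2)" "k \<ge> 1" using canonical_rep_value[OF g(2)] g(1) by (simp_all add: k_def)
    have *: "letter_count La k = trib_value (take (length g - 1) g) + 1"
      "letter_count La (trib_value (take (length g - 1) g) + 1) =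
        trib_value (take (length g - 2) g) + 1"
      "letter_count La (trib_value (take (length g - 2) g) + 1) =
        trib_value (take (length g - 3) g) + 1"
      using step[of g 0] step[of g 1] step[of g 2] g(3) canonical_rep_admissible[OF g(2)]
      by (auto simp: k_def numeral_2_eq_2 numeral_3_eq_3 simp flip: length_greater_0_conv)
    have "letter_count Lc n = letter_count Lb (letter_count La (k + 2))"
      using letter_count_Lc_Suc[of "k + 2"] \<open>n = Suc (k + 2)\<close> by simp
    also have "\<dots> = letter_count Lb (Suc (letter_count La k))"
      using letter_count_Lb_step[OF \<open>k \<ge> 1\<close>] by simp
    also have "\<dots> = letter_count La (letter_count La (letter_count La k))"
      using * by (intro letter_count_Lb_Suc) simp
    finally show "letter_count Lc n = trib_value (take (length g - 3) g) + 1"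
      using * by simp
  }
qed

end
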